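(* For each integer $n \geq 2$, $F_n^{(2)} = s_{n-1,1}$, where $F_n^{(2)} := \sum_{X \in \mathcal{C}^\infty_n} \eta(X)$ and $s_{n-1,1}$ is the Schur function of the partition $(n-1,1)$.
   Context: Let $X_1,X_2,\ldots$ be an infinite family of symbols. For $n\ge2$, let $\mathcal{C}^\infty_n$ be the set of all (formal, left-normed) brackets $[X_{i_1},X_{i_2},\ldots,X_{i_n}]$ indexed by tuples of positive integers with $$i_1 > i_2 \leq i_3 \leq \cdots \leq i_n,$$ distinct tuples giving distinct elements. Define $\eta([X_{i_1},\ldots,X_{i_n}]) := x_{i_1}x_{i_2}\cdots x_{i_n}$, a monomial in the variables $x_1,x_2,\ldots$. Thus $F_n^{(2)}$ is a formal power series with integer coefficients in countably many variables. The Schur function $s_\lambda$ is $\sum_\mu K_{\lambda\mu}m_\mu$, where $m_\mu$ is the monomial symmetric function and the Kostka number $K_{\lambda\mu}$ is the number of semi-standard Young tableaux of shape $\lambda$ and weight $\mu$ (rows non-decreasing, columns strictly increasing). *)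

theory Defs
  imports "HOL-Library.Poly_Mapping" "HOL-Library.Multiset"
begin

text \<open>
  A monomial in \<open>x\<^sub>1, x\<^sub>2, \<dots>\<close> is its finitely supported exponent vector, so that the product of
  monomials is addition. A formal power series is its coefficient function, hence need not have
  bounded degree or finite support. The index 0 belongs to no variable: every
  series defined below has coefficient 0 at exponent vectors whose support contains 0.
\<close>

type_synonym monomial = "nat \<Rightarrow>\<^sub>0 nat"
type_synonym power_series = "monomial \<Rightarrow> int"

definition of_monomial :: "monomial \<Rightarrow> power_series" where
  "of_monomial \<alpha> = (\<lambda>\<beta>. if \<beta> = \<alpha> then 1 else 0)"

definition locally_finite :: "('i \<Rightarrow> power_series) \<Rightarrow> 'i set \<Rightarrow> bool" where
  "locally_finite f I \<longleftrightarrow> (\<forall>\<alpha>. finite {i \<in> I. f i \<alpha> \<noteq> 0})"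

text \<open>
  The formal sum of a family of power series is taken coefficientwise. It is meaningful for locally
  finite families; all families it is applied to are shown to be locally finite below.
\<close>

definition formal_sum :: "('i \<Rightarrow> power_series) \<Rightarrow> 'i set \<Rightarrow> power_series" where
  "formal_sum f I = (\<lambda>\<alpha>. \<Sum>i | i \<in> I \<and> f i \<alpha> \<noteq> 0. f i \<alpha>)"


subsection \<open>Brackets\<close>

text \<open>
  Formal brackets are elements of the free magma on the symbols \<open>X\<^sub>i = Gen i\<close>; no Lie algebra
  relations are imposed.
\<close>

datatype bracket = Gen nat | Br bracket bracket

text \<open>\<open>left_normed [i\<^sub>1, \<dots>, i\<^sub>n]\<close> is \<open>[[\<dots>[[X\<^sub>i\<^sub>1, X\<^sub>i\<^sub>2], X\<^sub>i\<^sub>3], \<dots>], X\<^sub>i\<^sub>n]\<close>; it is only used for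
  nonempty lists.\<close>

definition left_normed :: "nat list \<Rightarrow> bracket" where
  "left_normed js = foldl Br (Gen (hd js)) (map Gen (tl js))"

definition C_inf :: "nat \<Rightarrow> bracket set" where
  "C_inf n = left_normed ` {js. length js = n \<and> (\<forall>j \<in> set js. 1 \<le> j) \<and>
     js ! 0 > js ! 1 \<and> sorted (tl js)}"

primrec eta :: "bracket \<Rightarrow> monomial" where
  "eta (Gen i) = Poly_Mapping.single i 1"
| "eta (Br a b) = eta a + eta b"

definition F2 :: "nat \<Rightarrow> power_series" where
  "F2 n = formal_sum (\<lambda>X. of_monomial (eta X)) (C_inf n)"

lemma left_normed_snoc:
  "js \<noteq> [] \<Longrightarrow> left_normed (js @ [j]) = Br (left_normed js) (Gen j)"
  by (simp add: left_normed_def)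

lemma eta_left_normed:
  "js \<noteq> [] \<Longrightarrow> eta (left_normed js) = (\<Sum>j\<leftarrow>js. Poly_Mapping.single j 1)"
proof (induction js rule: rev_induct)
  case (snoc j js)
  then show ?case
    by (cases "js = []") (simp_all add: left_normed_snoc, simp add: left_normed_def)
qed simp

lemma inj_on_left_normed: "inj_on left_normed {js. js \<noteq> []}"
proof -
  have "left_normed js = left_normed ks \<Longrightarrow> ks \<noteq> [] \<Longrightarrow> js = ks" if "js \<noteq> []" for js ks
    using that
  proof (induction js arbitrary: ks rule: rev_induct)
    case (snoc j js)
    show ?case
    proof (cases ks rule: rev_cases)
      case ks: (snoc ks' k)
      show ?thesis
        using snoc ks left_normed_snoc[of js j] left_normed_snoc[of ks' k]
        by (cases "js = []"; cases "ks' = []") (auto simp: left_normed_def)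
    qed (use snoc in simp)
  qed simp
  then show ?thesis by (auto simp: inj_on_def)
qed

lemma locally_finite_F2: "locally_finite (\<lambda>X. of_monomial (eta X)) (C_inf n)"
  unfolding locally_finite_def
proof
  fix \<alpha> :: monomial
  have keys: "set js \<subseteq> Poly_Mapping.keys (\<Sum>j\<leftarrow>js. Poly_Mapping.single j (1::nat))" for js
    by (induction js) (auto simp: in_keys_iff lookup_add lookup_single)
  have "{X \<in> C_inf n. of_monomial (eta X) \<alpha> \<noteq> 0}
      \<subseteq> insert (left_normed []) (left_normed ` {js. set js \<subseteq> Poly_Mapping.keys \<alpha> \<and> length js = n})"
  proof
    fix X assume "X \<in> {X \<in> C_inf n. of_monomial (eta X) \<alpha> \<noteq> 0}"
    then obtain js where "X = left_normed js" "length js = n" "eta (left_normed js) = \<alpha>"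
      by (auto simp: C_inf_def of_monomial_def split: if_splits)
    then show "X \<in> insert (left_normed []) (left_normed ` {js. set js \<subseteq> Poly_Mapping.keys \<alpha> \<and> length js = n})"
      using keys[of js] eta_left_normed[of js] by (cases "js = []") auto
  qed
  moreover have "finite (left_normed ` {js. set js \<subseteq> Poly_Mapping.keys \<alpha> \<and> length js = n})"
    by (intro finite_imageI finite_lists_length_eq) simp
  ultimately show "finite {X \<in> C_inf n. of_monomial (eta X) \<alpha> \<noteq> 0}"
    by (meson finite_insert finite_subset)
qed


subsection \<open>Schur functions\<close>

definition is_partition :: "nat list \<Rightarrow> bool" where
  "is_partition \<mu> \<longleftrightarrow> sorted_wrt (\<ge>) \<mu> \<and> 0 \<notin> set \<mu>"

text \<open>A tableau is the list of its rows. Rows and positions are counted from 0, entries from 1.\<close>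

definition semistandard :: "nat list \<Rightarrow> nat list list \<Rightarrow> bool" where
  "semistandard \<nu> T \<longleftrightarrow> map length T = \<nu> \<and> (\<forall>row \<in> set T. \<forall>x \<in> set row. 1 \<le> x) \<and>
     (\<forall>row \<in> set T. sorted row) \<and>
     (\<forall>r r' c. r < r' \<and> r' < length T \<and> c < length (T ! r') \<longrightarrow> T ! r ! c < T ! r' ! c)"

text \<open>The number of entries \<open>i\<close> is \<open>\<mu>\<^sub>i\<close>, which is 0 beyond the length of \<open>\<mu>\<close>.\<close>

definition has_weight :: "nat list list \<Rightarrow> nat list \<Rightarrow> bool" where
  "has_weight T \<mu> \<longleftrightarrow>
     (\<forall>i \<ge> 1. count_list (concat T) i = (if i \<le> length \<mu> then \<mu> ! (i - 1) else 0))"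

definition kostka :: "nat list \<Rightarrow> nat list \<Rightarrow> nat" where
  "kostka \<nu> \<mu> = card {T. semistandard \<nu> T \<and> has_weight T \<mu>}"

text \<open>The monomials occurring in \<open>m\<^sub>\<mu>\<close> are those whose nonzero exponents are the parts of \<open>\<mu>\<close>, in
  any order.\<close>

definition monomial_symmetric :: "nat list \<Rightarrow> power_series" where
  "monomial_symmetric \<mu> = formal_sum of_monomial
     {\<alpha>. 0 \<notin> Poly_Mapping.keys \<alpha> \<and>
       image_mset (Poly_Mapping.lookup \<alpha>) (mset_set (Poly_Mapping.keys \<alpha>)) = mset \<mu>}"

definition schur :: "nat list \<Rightarrow> power_series" where
  "schur \<nu> = formal_sum (\<lambda>\<mu> \<alpha>. int (kostka \<nu> \<mu>) * monomial_symmetric \<mu> \<alpha>) {\<mu>. is_partition \<mu>}"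

lemma finite_kostka: "finite {T. semistandard \<nu> T \<and> has_weight T \<mu>}"
proof (rule finite_subset)
  let ?R = "{row. set row \<subseteq> {..length \<mu>} \<and> length row \<le> sum_list \<nu>}"
  show "finite {T. set T \<subseteq> ?R \<and> length T = length \<nu>}"
    by (intro finite_lists_length_eq finite_lists_length_le) simp
  show "{T. semistandard \<nu> T \<and> has_weight T \<mu>} \<subseteq> {T. set T \<subseteq> ?R \<and> length T = length \<nu>}"
  proof safe
    fix T assume T: "semistandard \<nu> T" "has_weight T \<mu>"
    then show "length T = length \<nu>" by (auto simp: semistandard_def)
    fix row assume row: "row \<in> set T"
    then show "length row \<le> sum_list \<nu>"
      using T(1) by (auto simp: semistandard_def intro: member_le_sum_list)
    fix x assume x: "x \<in> set row"
    then have "1 \<le> x" using T row by (auto simp: semistandard_def)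
    moreover have "count_list (concat T) x \<noteq> 0"
      using x row by (auto simp: count_list_0_iff)
    ultimately show "x \<le> length \<mu>"
      using T(2) by (auto simp: has_weight_def split: if_splits)
  qed
qed

lemma locally_finite_of_monomial: "locally_finite of_monomial A"
  unfolding locally_finite_def of_monomial_def
  by (auto intro: finite_subset[of _ "{\<alpha>}" for \<alpha>])

lemma locally_finite_schur:
  "locally_finite (\<lambda>\<mu> \<alpha>. int (kostka \<nu> \<mu>) * monomial_symmetric \<mu> \<alpha>) {\<mu>. is_partition \<mu>}"
  unfolding locally_finite_def
proof
  fix \<alpha> :: monomial
  let ?M = "image_mset (Poly_Mapping.lookup \<alpha>) (mset_set (Poly_Mapping.keys \<alpha>))"
  have "?M = mset \<mu>" if "monomial_symmetric \<mu> \<alpha> \<noteq> 0" for \<mu>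
  proof (rule ccontr)
    assume "?M \<noteq> mset \<mu>"
    then have "monomial_symmetric \<mu> \<alpha> = 0"
      unfolding monomial_symmetric_def formal_sum_def of_monomial_def
      by (intro sum.neutral) auto
    with that show False by simp
  qed
  then have "{\<mu> \<in> {\<mu>. is_partition \<mu>}. int (kostka \<nu> \<mu>) * monomial_symmetric \<mu> \<alpha> \<noteq> 0}
      \<subseteq> {\<mu>. set \<mu> \<subseteq> set_mset ?M \<and> length \<mu> = size ?M}"
    by (auto simp del: set_image_mset size_image_mset)
  moreover have "finite {\<mu>. set \<mu> \<subseteq> set_mset ?M \<and> length \<mu> = size ?M}"
    by (intro finite_lists_length_eq) simp
  ultimately show "finite {\<mu> \<in> {\<mu>. is_partition \<mu>}. int (kostka \<nu> \<mu>) * monomial_symmetric \<mu> \<alpha> \<noteq> 0}"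
    by (rule finite_subset)
qed

end

theory Submission
  imports Defs
begin

text \<open>
  Both sides count the same objects: moving the second row of a tableau of shape \<open>(n - 1, 1)\<close> in
  front of its first row gives the index tuple of a bracket. For a given content \<open>M\<close>
  of size \<open>n\<close>, such a tuple is determined by its first entry, which can be any element of \<open>M\<close>
  except the minimum. The number of tuples therefore depends only on the number of distinct
  elements of \<open>M\<close>, so it is invariant under permuting the variables.
\<close>

definition hook_words :: "nat \<Rightarrow> nat multiset \<Rightarrow> nat list set" where
  "hook_words n M = {js. length js = n \<and> 0 \<notin> set js \<and> js ! 1 < js ! 0 \<and> sorted (tl js) \<and> mset js = M}"

text \<open>Sortedness lets the head \<open>b\<close> determine the rest of the word, whose first
  entry is the least element of \<open>M - {#b#}\<close>. That element lies below \<open>b\<close>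
  exactly when \<open>b\<close> is not the minimum of \<open>M\<close>: nothing lies below the
  minimum, and removing any other \<open>b\<close> leaves the minimum in place.\<close>

lemma hook_words_eq_image:
  assumes n: "n \<ge> 2" and M: "size M = n" "0 \<notin># M"
  shows "hook_words n M
    = (\<lambda>b. b # sorted_list_of_multiset (M - {#b#})) ` (set_mset M - {Min (set_mset M)})"
    (is "_ = ?f ` ?B")
proof (intro equalityI subsetI)
  fix js assume "js \<in> hook_words n M"
  then obtain b a as where js: "js = b # a # as" "a < b" "sorted (a # as)" "mset js = M"
    using n by (cases js; cases "tl js") (auto simp: hook_words_def)
  have "Min (set_mset M) \<le> a"
    using js(1,4) by (intro Min_le) auto
  then have "b \<in> ?B"
    using js by auto
  moreover have "sorted_list_of_multiset (M - {#b#}) = a # as"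
    using js by (metis add_mset_remove_trivial mset.simps(2) sorted_list_of_multiset_mset sorted_sort_id)
  ultimately show "js \<in> ?f ` ?B"
    using js(1) by auto
next
  fix js assume "js \<in> ?f ` ?B"
  then obtain b where b: "b \<in># M" "b \<noteq> Min (set_mset M)"
    and js: "js = b # sorted_list_of_multiset (M - {#b#})"
    by auto
  let ?m = "Min (set_mset M)"
  have "?m \<in># M"
    using b(1) by (intro Min_in) auto
  moreover have "?m \<le> b"
    using b(1) by simp
  ultimately have m: "?m \<in># M - {#b#}" "?m < b"
    using b(2) by (auto simp: in_diff_count)
  obtain a as where a: "sorted_list_of_multiset (M - {#b#}) = a # as"
    using m(1) by (metis empty_iff list.exhaust list.set(1) set_sorted_list_of_multiset)
  have "?m \<in> set (a # as)" "sorted (a # as)"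
    unfolding a[symmetric] using m(1) by (simp_all only: set_sorted_list_of_multiset sorted_sorted_list_of_multiset)
  then have "a \<le> ?m"
    by auto
  have mset: "mset js = M"
    using b(1) js by simp
  then have "length js = n" "set js = set_mset M"
    using M(1) by (metis size_mset, metis set_mset_mset)
  with \<open>a \<le> ?m\<close> m(2) \<open>sorted (a # as)\<close> mset M(2) show "js \<in> hook_words n M"
    by (simp add: hook_words_def js a)
qed

text \<open>Distinct heads give distinct words. As \<open>n \<ge> 2\<close>, a content of size
  \<open>n\<close> is nonempty, so its minimum is a genuine element and exactly one head is
  excluded.\<close>

lemma card_hook_words:
  assumes "n \<ge> 2"
  shows "card (hook_words n M) = (if size M = n \<and> 0 \<notin># M then card (set_mset M) - 1 else 0)"
proof (cases "size M = n \<and> 0 \<notin># M")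
  case True
  then have "Min (set_mset M) \<in> set_mset M"
    using assms by (intro Min_in) auto
  then show ?thesis
    using True by (simp add: hook_words_eq_image[OF assms] card_image inj_on_def)
next
  case False
  then have "hook_words n M = {}"
    by (auto simp: hook_words_def)
  with False show ?thesis
    by auto
qed

text \<open>The indices with nonzero coefficient form the fibre of \<open>g\<close> over
  \<open>\<alpha>\<close>, and each contributes 1. On an infinite fibre the sum and
  \<open>card\<close> both default to 0.\<close>

lemma formal_sum_of_monomial:
  "formal_sum (\<lambda>i. of_monomial (g i)) I \<alpha> = int (card {i \<in> I. g i = \<alpha>})"
proof -
  have "{i. i \<in> I \<and> of_monomial (g i) \<alpha> \<noteq> 0} = {i \<in> I. g i = \<alpha>}"
    by (auto simp: of_monomial_def)
  then show ?thesis
    by (simp add: formal_sum_def of_monomial_def)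
qed

lemma lookup_eta_left_normed:
  "js \<noteq> [] \<Longrightarrow> Poly_Mapping.lookup (eta (left_normed js)) = count (mset js)"
proof -
  have "Poly_Mapping.lookup (\<Sum>j\<leftarrow>js. Poly_Mapping.single j (1::nat)) i = count (mset js) i" for i
    by (induction js) (auto simp: lookup_add lookup_single)
  then show "js \<noteq> [] \<Longrightarrow> ?thesis"
    by (auto simp: eta_left_normed)
qed

lemma F2_eq_card_hook_words:
  assumes "n \<ge> 2" and M: "count M = Poly_Mapping.lookup \<alpha>"
  shows "F2 n \<alpha> = int (card (hook_words n M))"
proof -
  have eta: "eta (left_normed js) = \<alpha> \<longleftrightarrow> mset js = M" if "length js = n" for js
  proof -
    have "js \<noteq> []"
      using that assms(1) by auto
    then show ?thesis
      using M lookup_eta_left_normed[of js] by (metis count_inject lookup_inject)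
  qed
  have "(\<forall>j\<in>set js. 1 \<le> j) \<longleftrightarrow> 0 \<notin> set js" for js :: "nat list"
    by (metis less_one not_le)
  then have "{X \<in> C_inf n. eta X = \<alpha>} = left_normed ` hook_words n M"
    unfolding C_inf_def hook_words_def using eta by blast
  \<comment> \<open>Words of length at least 2 are nonempty, and there \<open>left_normed\<close> is
    injective; so brackets may be counted by their tuples.\<close>
  moreover have "inj_on left_normed (hook_words n M)"
    using assms(1) by (intro inj_on_subset[OF inj_on_left_normed]) (auto simp: hook_words_def)
  ultimately show ?thesis
    by (simp add: F2_def formal_sum_of_monomial card_image)
qed

text \<open>The second row has a single cell, so column strictness reduces to one inequality in
  column 0.\<close>

lemma semistandard_hook_iff:
  assumes "n \<ge> 2"
  shows "semistandard [n - 1, 1] T \<longleftrightarrow> (\<exists>b as. T = [as, [b]] \<and> length as = n - 1 \<and>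
    0 \<notin> set (b # as) \<and> sorted as \<and> as ! 0 < b)" (is "?L \<longleftrightarrow> ?R")
proof
  assume L: ?L
  then have len: "map length T = [n - 1, 1]"
    by (simp add: semistandard_def)
  then obtain as bs where T: "T = [as, bs]" "length as = n - 1" "length bs = 1"
    by (auto simp: map_eq_Cons_conv)
  then obtain b where b: "bs = [b]"
    by (auto simp: length_Suc_conv)
  have "\<forall>r r' c. r < r' \<and> r' < length T \<and> c < length (T ! r') \<longrightarrow> T ! r ! c < T ! r' ! c"
    using L by (simp add: semistandard_def)
  from this[rule_format, of 0 1 0] have "as ! 0 < b"
    by (simp add: T(1) b)
  moreover have "0 \<notin> set (b # as)" "sorted as"
    using L by (auto simp: semistandard_def T(1) b)
  ultimately show ?R
    using T(1,2) b by blast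
next
  assume ?R
  then obtain b as where T: "T = [as, [b]]" "length as = n - 1" "sorted as" "as ! 0 < b"
    and pos: "0 \<notin> set (b # as)"
    by blast
  have "1 \<le> x" if "x \<in> set (b # as)" for x
    using pos that by (cases x) auto
  then show ?L
    using T(2-4) by (auto simp: semistandard_def T(1) less_Suc_eq)
qed

lemma kostka_hook_eq_card_hook_words:
  assumes "n \<ge> 2" and M: "count M = (\<lambda>i. if 1 \<le> i \<and> i \<le> length \<mu> then \<mu> ! (i - 1) else 0)"
  shows "kostka [n - 1, 1] \<mu> = card (hook_words n M)"
proof -
  have weight: "has_weight [as, [b]] \<mu> \<longleftrightarrow> mset (b # as) = M" if "0 \<notin> set (b # as)" for as b
  proof -
    \<comment> \<open>\<open>has_weight\<close> does not constrain the entry 0. Both counts vanish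
      there, so agreement at positive entries already gives equal multisets.\<close>
    have "count (mset (b # as)) 0 = 0"
      using that by (metis count_eq_zero_iff set_mset_mset)
    moreover have "count M 0 = 0"
      by (simp add: M)
    ultimately have "mset (b # as) = M \<longleftrightarrow> (\<forall>i\<ge>1. count (mset (b # as)) i = count M i)"
      unfolding multiset_eq_iff by (metis less_one not_le)
    also have "\<dots> \<longleftrightarrow> has_weight [as, [b]] \<mu>"
      unfolding has_weight_def M count_mset by simp
    finally show ?thesis ..
  qed
  let ?f = "\<lambda>js. [tl js, [hd js]]"
  have "{T. semistandard [n - 1, 1] T \<and> has_weight T \<mu>} = ?f ` hook_words n M"
  proof (intro equalityI subsetI)
    fix T assume "T \<in> {T. semistandard [n - 1, 1] T \<and> has_weight T \<mu>}"
    then obtain b as where "T = [as, [b]]" "length as = n - 1" "0 \<notin> set (b # as)" "sorted as"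
      "as ! 0 < b" "mset (b # as) = M"
      unfolding semistandard_hook_iff[OF assms(1)] mem_Collect_eq using weight by metis
    then have "T = ?f (b # as)" "b # as \<in> hook_words n M"
      using assms(1) unfolding hook_words_def by simp_all
    then show "T \<in> ?f ` hook_words n M"
      by blast
  next
    fix T assume "T \<in> ?f ` hook_words n M"
    then obtain js where js: "T = ?f js" "js \<in> hook_words n M"
      by blast
    then obtain b as where "js = b # as"
      using assms(1) by (cases js) (auto simp: hook_words_def)
    with js show "T \<in> {T. semistandard [n - 1, 1] T \<and> has_weight T \<mu>}"
      unfolding semistandard_hook_iff[OF assms(1)] using weight[of b as] by (auto simp: hook_words_def)
  qed
  moreover have "inj_on ?f (hook_words n M)"
    using assms(1) by (intro inj_onI list.expand) (auto simp: hook_words_def)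
  ultimately show ?thesis
    by (simp add: kostka_def card_image)
qed

text \<open>A weight \<open>\<mu>\<close> without zero parts prescribes a content whose distinct
  elements are exactly \<open>1, ..., length \<mu>\<close>, so the count of words applies.\<close>

lemma kostka_hook:
  assumes "n \<ge> 2" "0 \<notin> set \<mu>"
  shows "kostka [n - 1, 1] \<mu> = (if sum_list \<mu> = n then length \<mu> - 1 else 0)"
proof -
  \<comment> \<open>The multiplicity function of the content: entries start at 1, list positions at
    0. Its finite support makes \<open>Abs_multiset c\<close> meaningful.\<close>
  define c where "c i = (if 1 \<le> i \<and> i \<le> length \<mu> then \<mu> ! (i - 1) else 0)" for i
  have supp: "{i. 0 < c i} = {1..length \<mu>}"
    using assms(2) by (force simp: c_def in_set_conv_nth)
  then have count: "count (Abs_multiset c) = c"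
    by (intro Abs_multiset_inverse) simp
  have set: "set_mset (Abs_multiset c) = {1..length \<mu>}"
    using supp by (simp add: set_mset_def count)
  have "size (Abs_multiset c) = (\<Sum>i\<in>{1..length \<mu>}. \<mu> ! (i - 1))"
    by (simp add: size_multiset_overloaded_eq set count c_def)
  also have "\<dots> = (\<Sum>i<length \<mu>. \<mu> ! i)"
    by (rule sum.reindex_bij_witness[of _ Suc "\<lambda>i. i - 1"]) auto
  also have "\<dots> = sum_list \<mu>"
    by (simp add: sum_list_sum_nth atLeast0LessThan)
  finally have "size (Abs_multiset c) = sum_list \<mu>" .
  moreover have "count (Abs_multiset c) = (\<lambda>i. if 1 \<le> i \<and> i \<le> length \<mu> then \<mu> ! (i - 1) else 0)"
    unfolding count by (simp add: c_def fun_eq_iff)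
  ultimately show ?thesis
    using kostka_hook_eq_card_hook_words[OF assms(1), of "Abs_multiset c" \<mu>]
    by (simp add: card_hook_words[OF assms(1)] set)
qed

text \<open>The partition type of the monomial: it forgets which variable carries which
  exponent.\<close>

definition exponents :: "monomial \<Rightarrow> nat multiset" where
  "exponents \<alpha> = image_mset (Poly_Mapping.lookup \<alpha>) (mset_set (Poly_Mapping.keys \<alpha>))"

lemma monomial_symmetric_coeff:
  "monomial_symmetric \<mu> \<alpha> = (if 0 \<notin> Poly_Mapping.keys \<alpha> \<and> mset \<mu> = exponents \<alpha> then 1 else 0)"
proof -
  let ?A = "{\<alpha>. 0 \<notin> Poly_Mapping.keys \<alpha> \<and> exponents \<alpha> = mset \<mu>}"
  have "{\<beta> \<in> ?A. \<beta> = \<alpha>} = (if \<alpha> \<in> ?A then {\<alpha>} else {})"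
    by auto
  then have "int (card {\<beta> \<in> ?A. \<beta> = \<alpha>}) = (if \<alpha> \<in> ?A then 1 else 0)"
    by simp
  then show ?thesis
    unfolding monomial_symmetric_def exponents_def[symmetric]
    by (simp only: formal_sum_of_monomial[of "\<lambda>\<beta>. \<beta>"]) auto
qed

lemma is_partition_iff: "is_partition \<mu> \<longleftrightarrow> sorted (rev \<mu>) \<and> 0 \<notin> set \<mu>"
  by (simp add: is_partition_def sorted_wrt_rev)

text \<open>Among all partitions only the decreasing rearrangement of the exponents of
  \<open>\<alpha>\<close> has a monomial symmetric function that can contain
  \<open>\<alpha>\<close>, so the sum collapses to one Kostka number.\<close>

lemma schur_coeff:
  fixes \<nu> \<alpha>
  defines "\<mu> \<equiv> rev (sorted_list_of_multiset (exponents \<alpha>))"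
  shows "schur \<nu> \<alpha> = (if 0 \<notin> Poly_Mapping.keys \<alpha> then int (kostka \<nu> \<mu>) else 0)"
proof -
  let ?f = "\<lambda>\<mu>. int (kostka \<nu> \<mu>) * monomial_symmetric \<mu> \<alpha>"
  have mset: "mset \<mu> = exponents \<alpha>"
    by (simp add: \<mu>_def)
  have "0 \<notin># exponents \<alpha>"
    by (auto simp: exponents_def in_keys_iff)
  then have part: "is_partition \<mu>"
    by (simp add: is_partition_iff \<mu>_def)
  \<comment> \<open>A reversed partition is sorted, hence determined by its multiset of
    parts.\<close>
  have unique: "\<mu>' = \<mu>" if "is_partition \<mu>'" "mset \<mu>' = exponents \<alpha>" for \<mu>'
  proof -
    have "sorted_list_of_multiset (mset (rev \<mu>')) = rev \<mu>'"
      using that(1) by (simp only: sorted_list_of_multiset_mset is_partition_iff sorted_sort_id)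
    then show ?thesis
      using that(2) by (simp add: \<mu>_def)
  qed
  have zero: "?f \<mu>' = 0" if "is_partition \<mu>'" "\<mu>' \<noteq> \<mu>" for \<mu>'
    using that unique by (auto simp: monomial_symmetric_coeff)
  have "schur \<nu> \<alpha> = (\<Sum>\<mu>' | is_partition \<mu>' \<and> ?f \<mu>' \<noteq> 0. ?f \<mu>')"
    by (simp add: schur_def formal_sum_def)
  also have "\<dots> = (\<Sum>\<mu>'\<in>{\<mu>}. ?f \<mu>')"
    using zero part by (intro sum.mono_neutral_left) blast+
  finally show ?thesis
    by (simp add: monomial_symmetric_coeff mset)
qed

theorem theorem4p11:
  fixes n :: nat
  assumes "n \<ge> 2"
  shows "F2 n = schur [n - 1, 1]"
proof
  fix \<alpha> :: monomial
  let ?K = "Poly_Mapping.keys \<alpha>"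
  \<comment> \<open>\<open>?M\<close> holds the variable indices with multiplicity, whereas
    \<open>?\<mu>\<close> holds the exponents. The number of distinct indices is the number of parts
    of \<open>?\<mu>\<close>, and both have total degree \<open>size ?M\<close>.\<close>
  let ?M = "Abs_multiset (Poly_Mapping.lookup \<alpha>)"
  let ?\<mu> = "rev (sorted_list_of_multiset (exponents \<alpha>))"
  have count: "count ?M = Poly_Mapping.lookup \<alpha>"
    by (rule Abs_multiset_inverse) simp
  have set: "set_mset ?M = ?K"
    by (auto simp: set_mset_def count in_keys_iff)
  have size: "size ?M = sum (Poly_Mapping.lookup \<alpha>) ?K"
    by (simp add: size_multiset_overloaded_eq set count)
  have "length ?\<mu> = card ?K"
    by (simp add: exponents_def flip: size_mset)
  moreover have "sum_list ?\<mu> = size ?M"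
    by (simp add: size exponents_def sum_unfold_sum_mset flip: sum_mset_sum_list)
  moreover have "0 \<notin> set ?\<mu>"
    by (auto simp: exponents_def in_keys_iff)
  \<comment> \<open>Both coefficients are \<open>card ?K - 1\<close> if the degree is
    \<open>n\<close> and 0 is not in \<open>?K\<close>; otherwise both are 0.\<close>
  ultimately show "F2 n \<alpha> = schur [n - 1, 1] \<alpha>"
    unfolding schur_coeff F2_eq_card_hook_words[OF assms count] card_hook_words[OF assms] set
    using kostka_hook[OF assms, of ?\<mu>] by simp
qed

end
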